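(* Let $\mathbb{K}$ be a field of characteristic zero, $R$ a unital commutative associative $\mathbb{K}$-algebra, and let $\langle\cdot,\cdot\rangle\colon L\times N\to R$ be a duality pairing of two $R$-modules $L$ and $N$. Let $(D_0,X_0)\in\mathcal{CDO}(N)$, $y_0\in N$ and $E_0\in\mathrm{End}_{\mathbb{K}}(L)$ be such that the mapping $$L\times L\to R,\quad (\ell_1,\ell_2)\mapsto\langle\ell_1,y_0\rangle\,\langle\ell_2,(D_0)^2(y_0)\rangle$$ is symmetric and $$X_0(\langle\ell,n\rangle)=\langle E_0(\ell),n\rangle+\langle\ell,D_0(n)\rangle\quad\text{for all }\ell\in L,\ n\in N.$$ Define the anchor $\rho^L\colon L\to T_R$, $\rho^L(\ell):=\langle\ell,y_0\rangle X_0$. Then the mapping $$\nabla\colon L\to\mathcal{CDO}(L),\quad \nabla(\ell):=(\langle\ell,y_0\rangle E_0-\langle\ell,D_0(y_0)\rangle\,\mathrm{id}_L,\ \rho^L(\ell))\in\widetilde{\mathcal{CDO}}(L)\times T_R$$ is a well-defined $L$-connection on the anchored module $L$ with its anchor $\rho^L$, and the mapping $$L\times L\to L,\quad(\ell_1,\ell_2)\mapsto\ell_1\cdot\ell_2:=\nabla_{\ell_1}\ell_2=\langle\ell_1,y_0\rangle E_0(\ell_2)-\langle\ell_1,D_0(y_0)\rangle\ell_2$$ defines the structure of a pre-Lie-Rinehart algebra on $L$.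
   Context: $R$-modules are unital left modules. $T_R:=\mathrm{Der}(R)$ is the $R$-module and Lie algebra (under commutators) of all $\mathbb{K}$-linear derivations $R\to R$. A duality pairing of $R$-modules $L,N$ is an $R$-bilinear map $\langle\cdot,\cdot\rangle\colon L\times N\to R$ such that for $\ell\in L$: $\ell=0\iff\langle\ell,N\rangle=\{0\}$, and for $n\in N$: $n=0\iff\langle L,n\rangle=\{0\}$. For an $R$-module $N$ and $r\in R$ let $\mu^N(r)\colon N\to N$, $n\mapsto rn$. Define $\widetilde{\mathcal{CDO}}(N):=\{D\in\mathrm{End}_{\mathbb{K}}(N)\mid[D,\mu^N(R)]\subseteq\mu^N(R)\}$ and $$\mathcal{CDO}(N):=\{(D,X)\in\mathrm{End}_{\mathbb{K}}(N)\times\mathrm{Der}(R)\mid[D,\mu^N(r)]=\mu^N(X(r))\text{ for all }r\in R\},$$ i.e. $D(rn)=rD(n)+X(r)n$ for all $r\in R$, $n\in N$. $\mathcal{CDO}(N)$ is a Lie subalgebra and an $R$-submodule of $\mathrm{End}_{\mathbb{K}}(N)\times\mathrm{Der}(R)$, where $r\cdot(D,X)=(\mu^N(r)D,rX)$; its anchor is $\rho^{\mathcal{CDO}(N)}(D,X):=X$. An anchored module is an $R$-module $L$ with an $R$-linear map $\rho^L\colon L\to T_R$ (anchor). An $L$-connection on an anchored module $L$ is an $R$-linear map $\nabla\colon L\to\mathcal{CDO}(L)$ with $\rho^{\mathcal{CDO}(L)}\circ\nabla=\rho^L$; one writes $\nabla(\ell)=(\nabla_\ell,\rho^L(\ell))$.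 A pre-Lie-Rinehart algebra structure on an anchored module $L$ is an $L$-connection $\nabla\colon L\to\mathcal{CDO}(L)$ such that, with $\ell_1\cdot\ell_2:=\nabla_{\ell_1}\ell_2$ and $[\ell_1,\ell_2]:=\ell_1\cdot\ell_2-\ell_2\cdot\ell_1$: (a) the associator $(\ell_1,\ell_2,\ell_3):=\ell_1\cdot(\ell_2\cdot\ell_3)-(\ell_1\cdot\ell_2)\cdot\ell_3$ satisfies $(\ell_1,\ell_2,\ell_3)=(\ell_2,\ell_1,\ell_3)$ for all $\ell_1,\ell_2,\ell_3\in L$; (b) $\rho^L([\ell_1,\ell_2])=[\rho^L(\ell_1),\rho^L(\ell_2)]$ for all $\ell_1,\ell_2\in L$. *)

theory Defs
  imports "HOL-Algebra.Module"
begin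

section \<open>Modules and linear maps\<close>

text \<open>The record of modules extends the record of rings; the fields \<open>mult\<close> and \<open>one\<close>
  play no role in the locale \<open>module\<close> and are left unspecified here.\<close>

definition mk_module ::
    "'m set \<Rightarrow> 'm \<Rightarrow> ('m \<Rightarrow> 'm \<Rightarrow> 'm) \<Rightarrow> ('r \<Rightarrow> 'm \<Rightarrow> 'm) \<Rightarrow> ('r, 'm) module" where
  "mk_module A z a s =
     \<lparr>carrier = A, mult = undefined, one = undefined, zero = z, add = a, smult = s\<rparr>"

definition regular_module :: "('r, 'a) ring_scheme \<Rightarrow> ('r, 'r) module" where
  "regular_module R = mk_module (carrier R) \<zero>\<^bsub>R\<^esub> (\<oplus>\<^bsub>R\<^esub>) (\<otimes>\<^bsub>R\<^esub>)"

text \<open>An \<open>R\<close>-module \<open>N\<close> over a \<open>K\<close>-algebra \<open>R\<close>, regarded as a \<open>K\<close>-vector space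
  through \<open>k \<mapsto> k \<cdot> 1\<close>.\<close>

definition restrict_scalars ::
    "('k, 'r, 'a) module_scheme \<Rightarrow> ('r, 'n, 'b) module_scheme \<Rightarrow> ('k, 'n) module" where
  "restrict_scalars R N =
     mk_module (carrier N) \<zero>\<^bsub>N\<^esub> (\<oplus>\<^bsub>N\<^esub>) (\<lambda>k n. (k \<odot>\<^bsub>R\<^esub> \<one>\<^bsub>R\<^esub>) \<odot>\<^bsub>N\<^esub> n)"

definition linear_maps ::
    "('r, 'c) ring_scheme \<Rightarrow> ('r, 'm, 'a) module_scheme \<Rightarrow> ('r, 'n, 'b) module_scheme
      \<Rightarrow> ('m \<Rightarrow> 'n) set" where
  "linear_maps R M N =
     {f \<in> carrier M \<rightarrow> carrier N.
        (\<forall>x\<in>carrier M. \<forall>y\<in>carrier M. f (x \<oplus>\<^bsub>M\<^esub> y) = f x \<oplus>\<^bsub>N\<^esub> f y) \<and>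
        (\<forall>r\<in>carrier R. \<forall>x\<in>carrier M. f (r \<odot>\<^bsub>M\<^esub> x) = r \<odot>\<^bsub>N\<^esub> f x)}"

text \<open>Endomorphisms are taken extensional on the carrier, so that equality of functions is
  equality of maps on the module.\<close>

definition endos ::
    "('k, 'c) ring_scheme \<Rightarrow> ('k, 'm, 'a) module_scheme \<Rightarrow> ('m \<Rightarrow> 'm) set" where
  "endos K M = linear_maps K M M \<inter> extensional (carrier M)"

definition commutator :: "('m, 'a) ring_scheme \<Rightarrow> ('m \<Rightarrow> 'm) \<Rightarrow> ('m \<Rightarrow> 'm) \<Rightarrow> 'm \<Rightarrow> 'm" where
  "commutator M f g = (\<lambda>x\<in>carrier M. f (g x) \<ominus>\<^bsub>M\<^esub> g (f x))"

definition char_zero :: "('k, 'c) ring_scheme \<Rightarrow> bool" where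
  "char_zero K \<longleftrightarrow> (\<forall>n::nat. 0 < n \<longrightarrow> [n] \<cdot>\<^bsub>K\<^esub> \<one>\<^bsub>K\<^esub> \<noteq> \<zero>\<^bsub>K\<^esub>)"

definition duality_pairing ::
    "('r, 'a) ring_scheme \<Rightarrow> ('r, 'l, 'b) module_scheme \<Rightarrow> ('r, 'n, 'c) module_scheme
      \<Rightarrow> ('l \<Rightarrow> 'n \<Rightarrow> 'r) \<Rightarrow> bool" where
  "duality_pairing R L N p \<longleftrightarrow>
     (\<forall>l\<in>carrier L. (\<lambda>n. p l n) \<in> linear_maps R N (regular_module R)) \<and>
     (\<forall>n\<in>carrier N. (\<lambda>l. p l n) \<in> linear_maps R L (regular_module R)) \<and>
     (\<forall>l\<in>carrier L. l = \<zero>\<^bsub>L\<^esub> \<longleftrightarrow> p l ` carrier N = {\<zero>\<^bsub>R\<^esub>}) \<and>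
     (\<forall>n\<in>carrier N. n = \<zero>\<^bsub>N\<^esub> \<longleftrightarrow> (\<lambda>l. p l n) ` carrier L = {\<zero>\<^bsub>R\<^esub>})"

section \<open>Derivations and covariant differential operators\<close>

definition derivations ::
    "('k, 'c) ring_scheme \<Rightarrow> ('k, 'r, 'a) module_scheme \<Rightarrow> ('r \<Rightarrow> 'r) set" where
  "derivations K R =
     {X \<in> endos K R. \<forall>x\<in>carrier R. \<forall>y\<in>carrier R.
        X (x \<otimes>\<^bsub>R\<^esub> y) = X x \<otimes>\<^bsub>R\<^esub> y \<oplus>\<^bsub>R\<^esub> x \<otimes>\<^bsub>R\<^esub> X y}"

definition T_module ::
    "('k, 'c) ring_scheme \<Rightarrow> ('k, 'r, 'a) module_scheme \<Rightarrow> ('r, 'r \<Rightarrow> 'r) module" where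
  "T_module K R = mk_module (derivations K R)
     (\<lambda>x\<in>carrier R. \<zero>\<^bsub>R\<^esub>)
     (\<lambda>X Y. \<lambda>x\<in>carrier R. X x \<oplus>\<^bsub>R\<^esub> Y x)
     (\<lambda>r X. \<lambda>x\<in>carrier R. r \<otimes>\<^bsub>R\<^esub> X x)"

definition mult_op :: "('r, 'n, 'b) module_scheme \<Rightarrow> 'r \<Rightarrow> 'n \<Rightarrow> 'n" where
  "mult_op N r = (\<lambda>n\<in>carrier N. r \<odot>\<^bsub>N\<^esub> n)"

definition CDO_tilde ::
    "('k, 'c) ring_scheme \<Rightarrow> ('k, 'r, 'a) module_scheme \<Rightarrow> ('r, 'n, 'b) module_scheme
      \<Rightarrow> ('n \<Rightarrow> 'n) set" where
  "CDO_tilde K R N =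
     {D \<in> endos K (restrict_scalars R N).
        (\<lambda>r. commutator N D (mult_op N r)) ` carrier R \<subseteq> mult_op N ` carrier R}"

definition CDO ::
    "('k, 'c) ring_scheme \<Rightarrow> ('k, 'r, 'a) module_scheme \<Rightarrow> ('r, 'n, 'b) module_scheme
      \<Rightarrow> (('n \<Rightarrow> 'n) \<times> ('r \<Rightarrow> 'r)) set" where
  "CDO K R N =
     {(D, X) \<in> endos K (restrict_scalars R N) \<times> derivations K R.
        \<forall>r\<in>carrier R. commutator N D (mult_op N r) = mult_op N (X r)}"

definition CDO_module ::
    "('k, 'c) ring_scheme \<Rightarrow> ('k, 'r, 'a) module_scheme \<Rightarrow> ('r, 'n, 'b) module_scheme
      \<Rightarrow> ('r, ('n \<Rightarrow> 'n) \<times> ('r \<Rightarrow> 'r)) module" where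
  "CDO_module K R N = mk_module (CDO K R N)
     (\<lambda>n\<in>carrier N. \<zero>\<^bsub>N\<^esub>, \<zero>\<^bsub>T_module K R\<^esub>)
     (\<lambda>(D, X) (E, Y). (\<lambda>n\<in>carrier N. D n \<oplus>\<^bsub>N\<^esub> E n, X \<oplus>\<^bsub>T_module K R\<^esub> Y))
     (\<lambda>r (D, X). (compose (carrier N) (mult_op N r) D, r \<odot>\<^bsub>T_module K R\<^esub> X))"

section \<open>Anchored modules, connections and pre-Lie-Rinehart algebras\<close>

definition anchored_module ::
    "('k, 'c) ring_scheme \<Rightarrow> ('k, 'r, 'a) module_scheme \<Rightarrow> ('r, 'l, 'b) module_scheme
      \<Rightarrow> ('l \<Rightarrow> 'r \<Rightarrow> 'r) \<Rightarrow> bool" where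
  "anchored_module K R L \<rho> \<longleftrightarrow> module R L \<and> \<rho> \<in> linear_maps R L (T_module K R)"

definition connection ::
    "('k, 'c) ring_scheme \<Rightarrow> ('k, 'r, 'a) module_scheme \<Rightarrow> ('r, 'l, 'b) module_scheme
      \<Rightarrow> ('l \<Rightarrow> 'r \<Rightarrow> 'r) \<Rightarrow> ('l \<Rightarrow> ('l \<Rightarrow> 'l) \<times> ('r \<Rightarrow> 'r)) \<Rightarrow> bool" where
  "connection K R L \<rho> nab \<longleftrightarrow>
     anchored_module K R L \<rho> \<and>
     nab \<in> linear_maps R L (CDO_module K R L) \<and>
     (\<forall>l\<in>carrier L. snd (nab l) = \<rho> l)"

definition conn_mult :: "('l \<Rightarrow> ('l \<Rightarrow> 'l) \<times> ('r \<Rightarrow> 'r)) \<Rightarrow> 'l \<Rightarrow> 'l \<Rightarrow> 'l" where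
  "conn_mult nab l m = fst (nab l) m"

definition associator ::
    "('l, 'a) ring_scheme \<Rightarrow> ('l \<Rightarrow> 'l \<Rightarrow> 'l) \<Rightarrow> 'l \<Rightarrow> 'l \<Rightarrow> 'l \<Rightarrow> 'l" where
  "associator L m x y z = m x (m y z) \<ominus>\<^bsub>L\<^esub> m (m x y) z"

definition pre_Lie_Rinehart ::
    "('k, 'c) ring_scheme \<Rightarrow> ('k, 'r, 'a) module_scheme \<Rightarrow> ('r, 'l, 'b) module_scheme
      \<Rightarrow> ('l \<Rightarrow> 'r \<Rightarrow> 'r) \<Rightarrow> ('l \<Rightarrow> ('l \<Rightarrow> 'l) \<times> ('r \<Rightarrow> 'r)) \<Rightarrow> bool" where
  "pre_Lie_Rinehart K R L \<rho> nab \<longleftrightarrow>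
     connection K R L \<rho> nab \<and>
     (\<forall>x\<in>carrier L. \<forall>y\<in>carrier L. \<forall>z\<in>carrier L.
        associator L (conn_mult nab) x y z = associator L (conn_mult nab) y x z) \<and>
     (\<forall>x\<in>carrier L. \<forall>y\<in>carrier L.
        \<rho> (conn_mult nab x y \<ominus>\<^bsub>L\<^esub> conn_mult nab y x) = commutator R (\<rho> x) (\<rho> y))"

end

theory Submission
  imports Defs
begin

text \<open>
  Write \<open>a l = \<langle>l, y0\<rangle>\<close>, \<open>b l = \<langle>l, D0 y0\<rangle>\<close>, \<open>c l = \<langle>l, D0 (D0 y0)\<rangle>\<close>, so that
  \<open>x \<cdot> y = a x E0 y - b x y\<close>.

  Everything rests on nondegeneracy of the pairing in its first argument: two elements of \<open>L\<close>
  agree as soon as they pair equally with all of \<open>N\<close> (lemma \<open>eq_if_pr_eq\<close>).  Together with the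
  adjointness relation \<open>X0 \<langle>l, n\<rangle> = \<langle>E0 l, n\<rangle> + \<langle>l, D0 n\<rangle>\<close>, it turns the derivation property of \<open>X0\<close>
  into a Leibniz rule for \<open>E0\<close>, which gives \<open>(E0, X0) \<in> CDO(L)\<close> (lemma \<open>adjoint_CDO\<close>).  Since
  covariant differential operators form an \<open>R\<close>-module and multiplications by scalars are such
  operators with zero anchor, every \<open>(f E0 - g id, f X0)\<close> is again one (lemma \<open>CDO_twist\<close>); this
  yields the connection.

  Adjointness at \<open>n = y0\<close> and \<open>n = D0 y0\<close> reads \<open>a (E0 l) = X0 (a l) - b l\<close> and
  \<open>b (E0 l) = X0 (b l) - c l\<close>.  With these two rules the associator of \<open>x\<close>, \<open>y\<close>, \<open>z\<close> becomes
  \<open>a x a y E0 (E0 z) - a x c y z\<close>: the terms in \<open>E0 z\<close>, those containing \<open>X0 (a y)\<close> or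
  \<open>X0 (b y)\<close>, and the products \<open>b x b y\<close> all cancel (lemma \<open>associator_prod\<close>).  The only term not
  visibly symmetric in \<open>x\<close> and \<open>y\<close> is \<open>a x c y z\<close>, and its symmetry is the hypothesis.  Likewise
  \<open>a (x \<cdot> y - y \<cdot> x) = a x X0 (a y) - a y X0 (a x)\<close>, which is the coefficient of \<open>X0\<close> in the
  commutator of \<open>a x X0\<close> and \<open>a y X0\<close> (lemma \<open>anchor_commutator\<close>).
\<close>

section \<open>Additive maps and scalar arithmetic\<close>

lemma additive_zero:
  assumes "abelian_group M" "abelian_group N" "f \<in> carrier M \<rightarrow> carrier N"
    and add: "\<And>x y. x \<in> carrier M \<Longrightarrow> y \<in> carrier M \<Longrightarrow> f (x \<oplus>\<^bsub>M\<^esub> y) = f x \<oplus>\<^bsub>N\<^esub> f y"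
  shows "f \<zero>\<^bsub>M\<^esub> = \<zero>\<^bsub>N\<^esub>"
proof -
  interpret M: abelian_group M by fact
  interpret N: abelian_group N by fact
  have c: "f \<zero>\<^bsub>M\<^esub> \<in> carrier N" using assms(3) by auto
  have "f \<zero>\<^bsub>M\<^esub> \<oplus>\<^bsub>N\<^esub> f \<zero>\<^bsub>M\<^esub> = f \<zero>\<^bsub>M\<^esub>"
    using add[of "\<zero>\<^bsub>M\<^esub>" "\<zero>\<^bsub>M\<^esub>"] by simp
  then show ?thesis using c by (simp add: N.add.r_cancel_one)
qed

lemma additive_diff:
  assumes "abelian_group M" "abelian_group N" "f \<in> carrier M \<rightarrow> carrier N"
    and add: "\<And>x y. x \<in> carrier M \<Longrightarrow> y \<in> carrier M \<Longrightarrow> f (x \<oplus>\<^bsub>M\<^esub> y) = f x \<oplus>\<^bsub>N\<^esub> f y"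
    and x: "x \<in> carrier M" and y: "y \<in> carrier M"
  shows "f (x \<ominus>\<^bsub>M\<^esub> y) = f x \<ominus>\<^bsub>N\<^esub> f y"
proof -
  interpret M: abelian_group M by fact
  interpret N: abelian_group N by fact
  have "f (\<ominus>\<^bsub>M\<^esub> y) \<oplus>\<^bsub>N\<^esub> f y = \<zero>\<^bsub>N\<^esub>"
    using add[of "\<ominus>\<^bsub>M\<^esub> y" y] additive_zero[OF assms(1-3) add] y by (simp add: M.l_neg)
  then have "f (\<ominus>\<^bsub>M\<^esub> y) = \<ominus>\<^bsub>N\<^esub> f y"
    using y assms(3) by (intro N.minus_equality[symmetric]) auto
  then show ?thesis using add[of x "\<ominus>\<^bsub>M\<^esub> y"] x y by (simp add: a_minus_def)
qed

lemma (in abelian_group) add_diff_add_cancel: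
  assumes "x \<in> carrier G" "y \<in> carrier G" "z \<in> carrier G"
  shows "(x \<oplus> y) \<ominus> (x \<oplus> z) = y \<ominus> z"
proof -
  have "(x \<oplus> y) \<ominus> (x \<oplus> z) = (x \<oplus> \<ominus> x) \<oplus> (y \<ominus> z)"
    using assms by (simp add: a_minus_def minus_add a_ac)
  then show ?thesis using assms by (simp add: r_neg)
qed

context module
begin

text \<open>Together with the laws of the abelian group, these rules bring an expression of the module
  to a sum of multiples of atoms whose scalar coefficients are products.\<close>

lemmas module_normalize =
  smult_l_distr smult_r_distr smult_assoc1[symmetric] smult_l_minus smult_r_minus
  a_minus_def M.minus_add M.a_ac R.m_ac R.l_distr R.r_distr R.l_minus R.r_minus R.minus_add

end

section \<open>Covariant differential operators\<close>

lemma endos_restrict_scalarsD: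
  assumes "D \<in> endos K (restrict_scalars R N)"
  shows "D \<in> carrier N \<rightarrow> carrier N"
    and "x \<in> carrier N \<Longrightarrow> y \<in> carrier N \<Longrightarrow> D (x \<oplus>\<^bsub>N\<^esub> y) = D x \<oplus>\<^bsub>N\<^esub> D y"
    and "k \<in> carrier K \<Longrightarrow> x \<in> carrier N \<Longrightarrow>
      D ((k \<odot>\<^bsub>R\<^esub> \<one>\<^bsub>R\<^esub>) \<odot>\<^bsub>N\<^esub> x) = (k \<odot>\<^bsub>R\<^esub> \<one>\<^bsub>R\<^esub>) \<odot>\<^bsub>N\<^esub> D x"
    and "D \<in> extensional (carrier N)"
  using assms by (simp_all add: endos_def linear_maps_def restrict_scalars_def mk_module_def)

lemma derivationsD:
  assumes "X \<in> derivations K R"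
  shows "X \<in> carrier R \<rightarrow> carrier R"
    and "x \<in> carrier R \<Longrightarrow> y \<in> carrier R \<Longrightarrow> X (x \<oplus>\<^bsub>R\<^esub> y) = X x \<oplus>\<^bsub>R\<^esub> X y"
    and "k \<in> carrier K \<Longrightarrow> x \<in> carrier R \<Longrightarrow> X (k \<odot>\<^bsub>R\<^esub> x) = k \<odot>\<^bsub>R\<^esub> X x"
    and "x \<in> carrier R \<Longrightarrow> y \<in> carrier R \<Longrightarrow>
      X (x \<otimes>\<^bsub>R\<^esub> y) = X x \<otimes>\<^bsub>R\<^esub> y \<oplus>\<^bsub>R\<^esub> x \<otimes>\<^bsub>R\<^esub> X y"
    and "X \<in> extensional (carrier R)"
  using assms by (simp_all add: derivations_def endos_def linear_maps_def)

text \<open>Turns the operator equation defining a covariant differential operator into the Leibniz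
  rule, the form in which it is checked and used below.\<close>

lemma CDO_iff_Leibniz:
  assumes "module R N"
  shows "(D, X) \<in> CDO K R N \<longleftrightarrow>
    D \<in> endos K (restrict_scalars R N) \<and> X \<in> derivations K R \<and>
    (\<forall>r\<in>carrier R. \<forall>n\<in>carrier N.
       D (r \<odot>\<^bsub>N\<^esub> n) = r \<odot>\<^bsub>N\<^esub> D n \<oplus>\<^bsub>N\<^esub> X r \<odot>\<^bsub>N\<^esub> n)"
proof -
  interpret module R N by fact
  have "commutator N D (mult_op N r) = mult_op N (X r) \<longleftrightarrow>
      (\<forall>n\<in>carrier N. D (r \<odot>\<^bsub>N\<^esub> n) = r \<odot>\<^bsub>N\<^esub> D n \<oplus>\<^bsub>N\<^esub> X r \<odot>\<^bsub>N\<^esub> n)"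
    if D: "D \<in> endos K (restrict_scalars R N)" and X: "X \<in> derivations K R"
      and r: "r \<in> carrier R" for r
  proof -
    note cl = funcset_mem[OF endos_restrict_scalarsD(1)[OF D]] funcset_mem[OF derivationsD(1)[OF X]]
    have "u \<ominus>\<^bsub>N\<^esub> v = w \<longleftrightarrow> u = v \<oplus>\<^bsub>N\<^esub> w"
      if "u \<in> carrier N" "v \<in> carrier N" "w \<in> carrier N" for u v w
      using that M.add.inv_solve_right[of w u v] by (auto simp: a_minus_def M.a_comm)
    then show ?thesis
      using r cl unfolding commutator_def mult_op_def
      by (auto simp: fun_eq_iff restrict_def)
  qed
  then show ?thesis by (auto simp: CDO_def)
qed

lemma CDO_subset_CDO_tilde: "CDO K R N \<subseteq> CDO_tilde K R N \<times> derivations K R"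
  by (auto simp: CDO_def CDO_tilde_def derivations_def endos_def linear_maps_def)

lemma smult_T_module: "r \<odot>\<^bsub>T_module K R\<^esub> X = (\<lambda>x\<in>carrier R. r \<otimes>\<^bsub>R\<^esub> X x)"
  by (simp add: T_module_def mk_module_def)

lemma smult_derivation:
  assumes "algebra K R" and r: "r \<in> carrier R" and X: "X \<in> derivations K R"
  shows "r \<odot>\<^bsub>T_module K R\<^esub> X \<in> derivations K R"
proof -
  interpret R: cring R using \<open>algebra K R\<close> by (rule algebra.M_cring)
  interpret A: algebra K R by fact
  note cl = funcset_mem[OF derivationsD(1)[OF X]]
  have "r \<otimes>\<^bsub>R\<^esub> (k \<odot>\<^bsub>R\<^esub> x) = k \<odot>\<^bsub>R\<^esub> (r \<otimes>\<^bsub>R\<^esub> x)"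
    if "k \<in> carrier K" "x \<in> carrier R" for k x
    using that r A.smult_assoc2[of k x r] R.m_comm[of x r] R.m_comm[of "k \<odot>\<^bsub>R\<^esub> x" r] by simp
  then show ?thesis
    unfolding smult_T_module derivations_def endos_def linear_maps_def
    using r cl derivationsD(2-4)[OF X]
    by (auto simp: R.r_distr R.m_ac)
qed

text \<open>The combination \<open>f (D, X) - (g id, 0)\<close> inside the \<open>R\<close>-module of covariant differential
  operators; all operators of the connection are of this kind.\<close>

lemma CDO_twist:
  assumes "algebra K R" and "module R N" and DX: "(D, X) \<in> CDO K R N"
    and f: "f \<in> carrier R" and g: "g \<in> carrier R"
  shows "(\<lambda>n\<in>carrier N. f \<odot>\<^bsub>N\<^esub> D n \<ominus>\<^bsub>N\<^esub> g \<odot>\<^bsub>N\<^esub> n, f \<odot>\<^bsub>T_module K R\<^esub> X) \<in> CDO K R N"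
proof -
  interpret A: algebra K R by fact
  interpret module R N by fact
  from DX have D: "D \<in> endos K (restrict_scalars R N)" and X: "X \<in> derivations K R"
    and Leibniz: "\<And>r n. r \<in> carrier R \<Longrightarrow> n \<in> carrier N \<Longrightarrow>
      D (r \<odot>\<^bsub>N\<^esub> n) = r \<odot>\<^bsub>N\<^esub> D n \<oplus>\<^bsub>N\<^esub> X r \<odot>\<^bsub>N\<^esub> n"
    by (auto simp: CDO_iff_Leibniz[OF \<open>module R N\<close>])
  note cl = funcset_mem[OF endos_restrict_scalarsD(1)[OF D]] funcset_mem[OF derivationsD(1)[OF X]]
  let ?D = "\<lambda>n\<in>carrier N. f \<odot>\<^bsub>N\<^esub> D n \<ominus>\<^bsub>N\<^esub> g \<odot>\<^bsub>N\<^esub> n"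
  have k_one: "k \<odot>\<^bsub>R\<^esub> \<one>\<^bsub>R\<^esub> \<in> carrier R" if "k \<in> carrier K" for k
    using that by simp
  have "?D \<in> endos K (restrict_scalars R N)"
    unfolding endos_def linear_maps_def restrict_scalars_def mk_module_def
    using f g cl k_one
    by (auto simp: endos_restrict_scalarsD(2,3)[OF D] module_normalize)
  moreover have "?D (r \<odot>\<^bsub>N\<^esub> n) = r \<odot>\<^bsub>N\<^esub> ?D n \<oplus>\<^bsub>N\<^esub> (f \<odot>\<^bsub>T_module K R\<^esub> X) r \<odot>\<^bsub>N\<^esub> n"
    if "r \<in> carrier R" "n \<in> carrier N" for r n
    using that f g cl by (simp add: Leibniz smult_T_module module_normalize)
  ultimately show ?thesis
    using smult_derivation[OF \<open>algebra K R\<close> f X] by (simp add: CDO_iff_Leibniz[OF \<open>module R N\<close>])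
qed

section \<open>Duality pairings\<close>

locale paired_modules =
  R: cring R + A: algebra K R + L: module R L + N: module R N
  for K :: "('k, 'a) ring_scheme" and R :: "('k, 'r, 'b) module_scheme"
    and L :: "('r, 'l, 'c) module_scheme" and N :: "('r, 'n, 'd) module_scheme" +
  fixes pr :: "'l \<Rightarrow> 'n \<Rightarrow> 'r"
  assumes pairing: "duality_pairing R L N pr"
begin

lemma pr_closed [simp]: "l \<in> carrier L \<Longrightarrow> n \<in> carrier N \<Longrightarrow> pr l n \<in> carrier R"
  using pairing
  by (auto simp: duality_pairing_def linear_maps_def regular_module_def mk_module_def)

lemma pr_add_left:
  "l \<in> carrier L \<Longrightarrow> m \<in> carrier L \<Longrightarrow> n \<in> carrier N \<Longrightarrow>
   pr (l \<oplus>\<^bsub>L\<^esub> m) n = pr l n \<oplus>\<^bsub>R\<^esub> pr m n"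
  using pairing
  by (auto simp: duality_pairing_def linear_maps_def regular_module_def mk_module_def)

lemma pr_smult_left:
  "r \<in> carrier R \<Longrightarrow> l \<in> carrier L \<Longrightarrow> n \<in> carrier N \<Longrightarrow>
   pr (r \<odot>\<^bsub>L\<^esub> l) n = r \<otimes>\<^bsub>R\<^esub> pr l n"
  using pairing
  by (auto simp: duality_pairing_def linear_maps_def regular_module_def mk_module_def)

lemma pr_diff_left:
  "l \<in> carrier L \<Longrightarrow> m \<in> carrier L \<Longrightarrow> n \<in> carrier N \<Longrightarrow>
   pr (l \<ominus>\<^bsub>L\<^esub> m) n = pr l n \<ominus>\<^bsub>R\<^esub> pr m n"
  by (rule additive_diff[of L R "\<lambda>l. pr l n"])
    (auto simp: pr_add_left L.M.abelian_group_axioms R.is_abelian_group)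

lemma eq_if_pr_eq:
  assumes l: "l \<in> carrier L" and m: "m \<in> carrier L"
    and eq: "\<And>n. n \<in> carrier N \<Longrightarrow> pr l n = pr m n"
  shows "l = m"
proof -
  have "pr (l \<ominus>\<^bsub>L\<^esub> m) n = \<zero>\<^bsub>R\<^esub>" if "n \<in> carrier N" for n
    using pr_diff_left[OF l m that] eq[OF that] m that by (simp add: a_minus_def R.r_neg)
  then have "pr (l \<ominus>\<^bsub>L\<^esub> m) ` carrier N = {\<zero>\<^bsub>R\<^esub>}"
    using N.M.zero_closed by (auto simp: image_iff)
  then have "l \<ominus>\<^bsub>L\<^esub> m = \<zero>\<^bsub>L\<^esub>"
    using pairing l m by (simp add: duality_pairing_def)
  then show ?thesis
    using l m L.M.add.inv_solve_right[of "\<zero>\<^bsub>L\<^esub>" l m] by (simp add: a_minus_def)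
qed

end

section \<open>The connection of an adjoint pair of operators\<close>

locale adjoint_operators = paired_modules K R L N pr
  for K :: "('k, 'a) ring_scheme" and R :: "('k, 'r, 'b) module_scheme"
    and L :: "('r, 'l, 'c) module_scheme" and N :: "('r, 'n, 'd) module_scheme"
    and pr :: "'l \<Rightarrow> 'n \<Rightarrow> 'r" +
  fixes D :: "'n \<Rightarrow> 'n" and X :: "'r \<Rightarrow> 'r" and E :: "'l \<Rightarrow> 'l"
  assumes DX: "(D, X) \<in> CDO K R N"
    and E: "E \<in> endos K (restrict_scalars R L)"
    and adjoint: "l \<in> carrier L \<Longrightarrow> n \<in> carrier N \<Longrightarrow>
      X (pr l n) = pr (E l) n \<oplus>\<^bsub>R\<^esub> pr l (D n)"
begin

lemma D: "D \<in> endos K (restrict_scalars R N)" and X: "X \<in> derivations K R"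
  using DX by (auto simp: CDO_def)

lemma D_closed [simp]: "n \<in> carrier N \<Longrightarrow> D n \<in> carrier N"
  and X_closed [simp]: "r \<in> carrier R \<Longrightarrow> X r \<in> carrier R"
  and E_closed [simp]: "l \<in> carrier L \<Longrightarrow> E l \<in> carrier L"
  using endos_restrict_scalarsD(1)[OF D] derivationsD(1)[OF X] endos_restrict_scalarsD(1)[OF E]
  by auto

lemma X_mult: "r \<in> carrier R \<Longrightarrow> s \<in> carrier R \<Longrightarrow>
    X (r \<otimes>\<^bsub>R\<^esub> s) = X r \<otimes>\<^bsub>R\<^esub> s \<oplus>\<^bsub>R\<^esub> r \<otimes>\<^bsub>R\<^esub> X s"
  by (rule derivationsD(4)[OF X])

lemma pr_adjoint:
  "l \<in> carrier L \<Longrightarrow> n \<in> carrier N \<Longrightarrow> pr (E l) n = X (pr l n) \<ominus>\<^bsub>R\<^esub> pr l (D n)"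
  by (simp add: adjoint a_minus_def R.a_assoc R.r_neg)

text \<open>By adjointness, \<open>\<langle>E (r l), n\<rangle> = X (r \<langle>l, n\<rangle>) - r \<langle>l, D n\<rangle>\<close>, so the derivation property of \<open>X\<close>
  gives the Leibniz rule of \<open>E\<close> after pairing with an arbitrary \<open>n\<close>.\<close>

lemma E_Leibniz:
  assumes r: "r \<in> carrier R" and l: "l \<in> carrier L"
  shows "E (r \<odot>\<^bsub>L\<^esub> l) = r \<odot>\<^bsub>L\<^esub> E l \<oplus>\<^bsub>L\<^esub> X r \<odot>\<^bsub>L\<^esub> l"
  by (rule eq_if_pr_eq)
    (use r l in \<open>simp_all add: pr_adjoint pr_add_left pr_smult_left X_mult R.cring_simprules\<close>)

lemma adjoint_CDO: "(E, X) \<in> CDO K R L"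
  using E X E_Leibniz by (simp add: CDO_iff_Leibniz[OF L.module_axioms])

lemma E_diff: "l \<in> carrier L \<Longrightarrow> m \<in> carrier L \<Longrightarrow> E (l \<ominus>\<^bsub>L\<^esub> m) = E l \<ominus>\<^bsub>L\<^esub> E m"
  by (rule additive_diff)
    (auto simp: endos_restrict_scalarsD(2)[OF E] L.M.abelian_group_axioms)

end

locale adjoint_operators_at = adjoint_operators K R L N pr D X E
  for K :: "('k, 'a) ring_scheme" and R :: "('k, 'r, 'b) module_scheme"
    and L :: "('r, 'l, 'c) module_scheme" and N :: "('r, 'n, 'd) module_scheme"
    and pr :: "'l \<Rightarrow> 'n \<Rightarrow> 'r" and D :: "'n \<Rightarrow> 'n" and X :: "'r \<Rightarrow> 'r" and E :: "'l \<Rightarrow> 'l" +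
  fixes y :: 'n
  assumes y [simp]: "y \<in> carrier N"
begin

definition anchor :: "'l \<Rightarrow> 'r \<Rightarrow> 'r" where
  "anchor l = pr l y \<odot>\<^bsub>T_module K R\<^esub> X"

definition nabla :: "'l \<Rightarrow> ('l \<Rightarrow> 'l) \<times> ('r \<Rightarrow> 'r)" where
  "nabla l = (\<lambda>m\<in>carrier L. pr l y \<odot>\<^bsub>L\<^esub> E m \<ominus>\<^bsub>L\<^esub> pr l (D y) \<odot>\<^bsub>L\<^esub> m, anchor l)"

definition prod :: "'l \<Rightarrow> 'l \<Rightarrow> 'l" where
  "prod l m = pr l y \<odot>\<^bsub>L\<^esub> E m \<ominus>\<^bsub>L\<^esub> pr l (D y) \<odot>\<^bsub>L\<^esub> m"

lemma prod_closed [simp]: "l \<in> carrier L \<Longrightarrow> m \<in> carrier L \<Longrightarrow> prod l m \<in> carrier L"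
  by (simp add: prod_def)

lemma conn_mult_nabla: "m \<in> carrier L \<Longrightarrow> conn_mult nabla l m = prod l m"
  by (simp add: conn_mult_def nabla_def prod_def)

lemma nabla_CDO: "l \<in> carrier L \<Longrightarrow> nabla l \<in> CDO K R L"
  unfolding nabla_def anchor_def
  by (rule CDO_twist[OF A.algebra_axioms L.module_axioms adjoint_CDO]) simp_all

lemma anchored: "anchored_module K R L anchor"
proof -
  have "anchor l \<in> derivations K R" if "l \<in> carrier L" for l
    using that smult_derivation[OF A.algebra_axioms _ X] by (simp add: anchor_def)
  then show ?thesis
    unfolding anchored_module_def linear_maps_def
    by (auto simp: L.module_axioms anchor_def T_module_def mk_module_def
        pr_add_left pr_smult_left R.l_distr R.m_assoc cong: restrict_cong)
qed

text \<open>\<open>nabla\<close> is \<open>R\<close>-linear because \<open>l\<close> enters only through the coefficients \<open>pr l y\<close> and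
  \<open>pr l (D y)\<close>, which are linear in \<open>l\<close>.\<close>

lemma connection_nabla: "connection K R L anchor nabla"
proof -
  have anchor_lin: "anchor (l \<oplus>\<^bsub>L\<^esub> m) = anchor l \<oplus>\<^bsub>T_module K R\<^esub> anchor m"
      "r \<in> carrier R \<Longrightarrow> anchor (r \<odot>\<^bsub>L\<^esub> l) = r \<odot>\<^bsub>T_module K R\<^esub> anchor l"
    if "l \<in> carrier L" "m \<in> carrier L" for l m r
    using anchored that by (auto simp: anchored_module_def linear_maps_def)
  have "nabla (l \<oplus>\<^bsub>L\<^esub> m) = nabla l \<oplus>\<^bsub>CDO_module K R L\<^esub> nabla m"
    if "l \<in> carrier L" "m \<in> carrier L" for l m
    using that
    by (auto simp: nabla_def CDO_module_def mk_module_def anchor_lin pr_add_left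
        L.module_normalize fun_eq_iff restrict_def)
  moreover have "nabla (r \<odot>\<^bsub>L\<^esub> l) = r \<odot>\<^bsub>CDO_module K R L\<^esub> nabla l"
    if "r \<in> carrier R" "l \<in> carrier L" for r l
    using that
    by (auto simp: nabla_def CDO_module_def mk_module_def anchor_lin pr_smult_left
        mult_op_def compose_def L.module_normalize fun_eq_iff restrict_def)
  moreover have "nabla l \<in> carrier (CDO_module K R L)" if "l \<in> carrier L" for l
    using that nabla_CDO by (simp add: CDO_module_def mk_module_def)
  ultimately show ?thesis
    using anchored by (auto simp: connection_def linear_maps_def nabla_def)
qed

lemma pr_prod:
  "l \<in> carrier L \<Longrightarrow> m \<in> carrier L \<Longrightarrow> n \<in> carrier N \<Longrightarrow>
   pr (prod l m) n =
     pr l y \<otimes>\<^bsub>R\<^esub> (X (pr m n) \<ominus>\<^bsub>R\<^esub> pr m (D n)) \<ominus>\<^bsub>R\<^esub> pr l (D y) \<otimes>\<^bsub>R\<^esub> pr m n"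
  by (simp add: prod_def pr_diff_left pr_smult_left pr_adjoint)

lemma E_prod:
  assumes "l \<in> carrier L" "m \<in> carrier L"
  shows "E (prod l m) =
    (pr l y \<odot>\<^bsub>L\<^esub> E (E m) \<oplus>\<^bsub>L\<^esub> X (pr l y) \<odot>\<^bsub>L\<^esub> E m)
      \<ominus>\<^bsub>L\<^esub> (pr l (D y) \<odot>\<^bsub>L\<^esub> E m \<oplus>\<^bsub>L\<^esub> X (pr l (D y)) \<odot>\<^bsub>L\<^esub> m)"
  using assms by (simp add: prod_def E_diff E_Leibniz)

text \<open>The derivatives of \<open>pr m y\<close> and \<open>pr m (D y)\<close> produced by the Leibniz rule in \<open>l \<cdot> (m \<cdot> n)\<close> are
  exactly those produced by adjointness in \<open>(l \<cdot> m) \<cdot> n\<close>, hence cancel.\<close>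

lemma associator_prod:
  assumes l: "l \<in> carrier L" and m: "m \<in> carrier L" and n: "n \<in> carrier L"
  shows "associator L (conn_mult nabla) l m n =
    (pr l y \<otimes>\<^bsub>R\<^esub> pr m y) \<odot>\<^bsub>L\<^esub> E (E n)
      \<ominus>\<^bsub>L\<^esub> (pr l y \<otimes>\<^bsub>R\<^esub> pr m (D (D y))) \<odot>\<^bsub>L\<^esub> n"
    (is "_ = ?rhs")
proof -
  have "associator L (conn_mult nabla) l m n = prod l (prod m n) \<ominus>\<^bsub>L\<^esub> prod (prod l m) n"
    using l m n by (simp add: associator_def conn_mult_nabla)
  also have "\<dots> = ?rhs"
  proof (rule eq_if_pr_eq)
    fix u assume u: "u \<in> carrier N"
    \<comment> \<open>Pairing with \<open>u\<close> turns the claim into an identity in the commutative ring \<open>R\<close>.\<close>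
    define a b c p q s t where "a = pr l y" and "b = pr l (D y)" and "c = pr m y"
      and "p = pr m (D y)" and "q = pr (E (E n)) u" and "s = pr (E n) u" and "t = pr n u"
    define e f g where "e = X c" and "f = X p" and "g = pr m (D (D y))"
    note defs = a_def b_def c_def p_def q_def s_def t_def e_def f_def g_def
    have cl: "a \<in> carrier R" "b \<in> carrier R" "c \<in> carrier R" "p \<in> carrier R" "q \<in> carrier R"
      "s \<in> carrier R" "t \<in> carrier R" "e \<in> carrier R" "f \<in> carrier R" "g \<in> carrier R"
      using l m n u by (simp_all add: defs)
    have "pr (prod l (prod m n)) u =
        a \<otimes>\<^bsub>R\<^esub> (c \<otimes>\<^bsub>R\<^esub> q \<oplus>\<^bsub>R\<^esub> e \<otimes>\<^bsub>R\<^esub> s \<ominus>\<^bsub>R\<^esub> (p \<otimes>\<^bsub>R\<^esub> s \<oplus>\<^bsub>R\<^esub> f \<otimes>\<^bsub>R\<^esub> t))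
          \<ominus>\<^bsub>R\<^esub> b \<otimes>\<^bsub>R\<^esub> (c \<otimes>\<^bsub>R\<^esub> s \<ominus>\<^bsub>R\<^esub> p \<otimes>\<^bsub>R\<^esub> t)"
      unfolding prod_def[of l] using l m n u
      by (simp add: E_prod pr_diff_left pr_add_left pr_smult_left defs)
        (simp add: prod_def pr_diff_left pr_smult_left)
    moreover have "pr (prod (prod l m) n) u =
        (a \<otimes>\<^bsub>R\<^esub> (e \<ominus>\<^bsub>R\<^esub> p) \<ominus>\<^bsub>R\<^esub> b \<otimes>\<^bsub>R\<^esub> c) \<otimes>\<^bsub>R\<^esub> s
          \<ominus>\<^bsub>R\<^esub> (a \<otimes>\<^bsub>R\<^esub> (f \<ominus>\<^bsub>R\<^esub> g) \<ominus>\<^bsub>R\<^esub> b \<otimes>\<^bsub>R\<^esub> p) \<otimes>\<^bsub>R\<^esub> t"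
      unfolding prod_def[of "prod l m"] using l m n u
      by (simp add: pr_diff_left pr_smult_left pr_prod defs)
    moreover have "pr ?rhs u = a \<otimes>\<^bsub>R\<^esub> c \<otimes>\<^bsub>R\<^esub> q \<ominus>\<^bsub>R\<^esub> a \<otimes>\<^bsub>R\<^esub> g \<otimes>\<^bsub>R\<^esub> t"
      using l m n u by (simp add: pr_diff_left pr_smult_left defs)
    \<comment> \<open>The part \<open>w\<close> common to both products, where all cancellations take place.\<close>
    moreover define w where
      "w = (a \<otimes>\<^bsub>R\<^esub> (e \<ominus>\<^bsub>R\<^esub> p) \<ominus>\<^bsub>R\<^esub> b \<otimes>\<^bsub>R\<^esub> c) \<otimes>\<^bsub>R\<^esub> s \<ominus>\<^bsub>R\<^esub> (a \<otimes>\<^bsub>R\<^esub> f \<ominus>\<^bsub>R\<^esub> b \<otimes>\<^bsub>R\<^esub> p) \<otimes>\<^bsub>R\<^esub> t"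
    moreover have "w \<in> carrier R" using cl by (simp add: w_def)
    ultimately have "pr (prod l (prod m n)) u = w \<oplus>\<^bsub>R\<^esub> a \<otimes>\<^bsub>R\<^esub> c \<otimes>\<^bsub>R\<^esub> q"
      and "pr (prod (prod l m) n) u = w \<oplus>\<^bsub>R\<^esub> a \<otimes>\<^bsub>R\<^esub> g \<otimes>\<^bsub>R\<^esub> t"
      and "pr ?rhs u = a \<otimes>\<^bsub>R\<^esub> c \<otimes>\<^bsub>R\<^esub> q \<ominus>\<^bsub>R\<^esub> a \<otimes>\<^bsub>R\<^esub> g \<otimes>\<^bsub>R\<^esub> t"
      using cl by (simp_all add: R.cring_simprules)
    then show "pr (prod l (prod m n) \<ominus>\<^bsub>L\<^esub> prod (prod l m) n) u = pr ?rhs u"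
      using l m n u cl \<open>w \<in> carrier R\<close> by (simp add: pr_diff_left R.add_diff_add_cancel)
  qed (use l m n in simp_all)
  finally show ?thesis .
qed

lemma anchor_commutator:
  assumes l: "l \<in> carrier L" and m: "m \<in> carrier L"
  shows "anchor (prod l m \<ominus>\<^bsub>L\<^esub> prod m l) = commutator R (anchor l) (anchor m)"
proof -
  \<comment> \<open>The terms of \<open>pr (prod l m) y\<close> without a derivative are symmetric in \<open>l\<close> and \<open>m\<close>.\<close>
  let ?w = "\<ominus>\<^bsub>R\<^esub> (pr l y \<otimes>\<^bsub>R\<^esub> pr m (D y) \<oplus>\<^bsub>R\<^esub> pr l (D y) \<otimes>\<^bsub>R\<^esub> pr m y)"
  have "pr (prod l m \<ominus>\<^bsub>L\<^esub> prod m l) y =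
      (?w \<oplus>\<^bsub>R\<^esub> pr l y \<otimes>\<^bsub>R\<^esub> X (pr m y)) \<ominus>\<^bsub>R\<^esub> (?w \<oplus>\<^bsub>R\<^esub> pr m y \<otimes>\<^bsub>R\<^esub> X (pr l y))"
    using l m by (simp add: pr_diff_left pr_prod) (simp add: R.cring_simprules)
  also have "\<dots> = pr l y \<otimes>\<^bsub>R\<^esub> X (pr m y) \<ominus>\<^bsub>R\<^esub> pr m y \<otimes>\<^bsub>R\<^esub> X (pr l y)"
    using l m by (intro R.add_diff_add_cancel) simp_all
  finally have coeff: "pr (prod l m \<ominus>\<^bsub>L\<^esub> prod m l) y = \<dots>" .
  have "\<dots> \<otimes>\<^bsub>R\<^esub> X r = pr l y \<otimes>\<^bsub>R\<^esub> X (pr m y \<otimes>\<^bsub>R\<^esub> X r) \<ominus>\<^bsub>R\<^esub> pr m y \<otimes>\<^bsub>R\<^esub> X (pr l y \<otimes>\<^bsub>R\<^esub> X r)"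
    if r: "r \<in> carrier R" for r
  proof -
    \<comment> \<open>The second-order term \<open>v\<close> is common to both compositions.\<close>
    let ?v = "pr l y \<otimes>\<^bsub>R\<^esub> pr m y \<otimes>\<^bsub>R\<^esub> X (X r)"
    have "pr l y \<otimes>\<^bsub>R\<^esub> X (pr m y \<otimes>\<^bsub>R\<^esub> X r) = ?v \<oplus>\<^bsub>R\<^esub> pr l y \<otimes>\<^bsub>R\<^esub> X (pr m y) \<otimes>\<^bsub>R\<^esub> X r"
      and "pr m y \<otimes>\<^bsub>R\<^esub> X (pr l y \<otimes>\<^bsub>R\<^esub> X r) = ?v \<oplus>\<^bsub>R\<^esub> pr m y \<otimes>\<^bsub>R\<^esub> X (pr l y) \<otimes>\<^bsub>R\<^esub> X r"
      using l m r by (simp_all add: X_mult R.cring_simprules)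
    then show ?thesis
      using l m r by (simp add: R.add_diff_add_cancel) (simp add: R.cring_simprules)
  qed
  then show ?thesis
    by (auto simp: anchor_def smult_T_module commutator_def coeff l m fun_eq_iff restrict_def)
qed

lemma pre_Lie_nabla:
  assumes sym: "\<And>l m. l \<in> carrier L \<Longrightarrow> m \<in> carrier L \<Longrightarrow>
    pr l y \<otimes>\<^bsub>R\<^esub> pr m (D (D y)) = pr m y \<otimes>\<^bsub>R\<^esub> pr l (D (D y))"
  shows "pre_Lie_Rinehart K R L anchor nabla"
  using connection_nabla anchor_commutator
  by (auto simp: pre_Lie_Rinehart_def conn_mult_nabla associator_prod sym R.m_comm)

end

theorem theorem4p14:
  fixes K :: "('k, 'a) ring_scheme"
    and R :: "('k, 'r, 'b) module_scheme"
    and L :: "('r, 'l, 'c) module_scheme"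
    and N :: "('r, 'n, 'd) module_scheme"
    and pr :: "'l \<Rightarrow> 'n \<Rightarrow> 'r"
    and D0 :: "'n \<Rightarrow> 'n" and X0 :: "'r \<Rightarrow> 'r" and E0 :: "'l \<Rightarrow> 'l" and y0 :: 'n
  assumes "field K" and "char_zero K"
    and "algebra K R"
    and "module R L" and "module R N"
    and "duality_pairing R L N pr"
    and "(D0, X0) \<in> CDO K R N"
    and "y0 \<in> carrier N"
    and "E0 \<in> endos K (restrict_scalars R L)"
    and "\<forall>l1\<in>carrier L. \<forall>l2\<in>carrier L.
           pr l1 y0 \<otimes>\<^bsub>R\<^esub> pr l2 (D0 (D0 y0)) = pr l2 y0 \<otimes>\<^bsub>R\<^esub> pr l1 (D0 (D0 y0))"
    and "\<forall>l\<in>carrier L. \<forall>n\<in>carrier N. X0 (pr l n) = pr (E0 l) n \<oplus>\<^bsub>R\<^esub> pr l (D0 n)"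
  defines "\<rho> \<equiv> \<lambda>l. pr l y0 \<odot>\<^bsub>T_module K R\<^esub> X0"
  defines "nab \<equiv> \<lambda>l. (\<lambda>m\<in>carrier L. pr l y0 \<odot>\<^bsub>L\<^esub> E0 m \<ominus>\<^bsub>L\<^esub> pr l (D0 y0) \<odot>\<^bsub>L\<^esub> m, \<rho> l)"
  shows "nab \<in> carrier L \<rightarrow> CDO_tilde K R L \<times> derivations K R \<and>
         connection K R L \<rho> nab \<and>
         (\<forall>l1\<in>carrier L. \<forall>l2\<in>carrier L.
           conn_mult nab l1 l2 = pr l1 y0 \<odot>\<^bsub>L\<^esub> E0 l2 \<ominus>\<^bsub>L\<^esub> pr l1 (D0 y0) \<odot>\<^bsub>L\<^esub> l2) \<and>
         pre_Lie_Rinehart K R L \<rho> nab"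
proof -
  interpret R: cring R using \<open>algebra K R\<close> by (rule algebra.M_cring)
  interpret A: algebra K R by fact
  interpret L: module R L by fact
  interpret N: module R N by fact
  interpret adjoint_operators_at K R L N pr D0 X0 E0 y0
    by unfold_locales (use assms in auto)
  have eqs: "\<rho> = anchor" "nab = nabla"
    by (auto simp: \<rho>_def nab_def anchor_def nabla_def fun_eq_iff)
  have "nabla \<in> carrier L \<rightarrow> CDO_tilde K R L \<times> derivations K R"
    using nabla_CDO CDO_subset_CDO_tilde by blast
  then show ?thesis
    unfolding eqs using connection_nabla pre_Lie_nabla assms(10)
    by (auto simp: conn_mult_nabla prod_def)
qed

end
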